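(* Let $p=p(z)$ and $q=q(z)$ be smooth functions of $z$ and let $c$ be a constant. The isometric immersion $\varphi : \mathbb{R}^2\to (\mathbb{R}^{3},\ h=e^{2p(z)}dx^{2}+e^{2q(z)}dy^{2}+dz^{2})$ with $\varphi(x,y)=(x,y,c)$ is biharmonic if and only if $$p''+2p'^2+q''+2q'^2=0.$$ In particular, for any positive constants $A, B, C, D$, the upper half space $\mathbb{R}^{3}_+=\{(x,y,z) : z>0\}$ with the metric $h=(Az+B)dx^{2}+(Cz+D)dy^{2}+dz^{2}$ is foliated by proper biharmonic planes $z=\text{constant}$.
   Context: All manifolds, maps and tensor fields are smooth. Primes denote derivatives with respect to $z$, and $(x,y,z)$ are the standard coordinates on $\mathbb{R}^3$; $\mathbb{R}^2$ carries the metric induced by $\varphi$. A map $\varphi:(M,g)\to(N,h)$ between Riemannian manifolds has tension field $\tau(\varphi)=\mathrm{Trace}_g\nabla d\varphi$. It is biharmonic if it is a critical point of the bienergy $E^2(\varphi,\Omega)=\frac12\int_\Omega|\tau(\varphi)|^2dx$ for every compact $\Omega\subset M$; equivalently, its bitension field $$\tau^2(\varphi)=\mathrm{Trace}_g(\nabla^\varphi\nabla^\varphi-\nabla^\varphi_{\nabla^M})\tau(\varphi)-\mathrm{Trace}_g R^N(d\varphi,\tau(\varphi))d\varphi$$ vanishes identically, where $R^N(X,Y)Z=[\nabla^N_X,\nabla^N_Y]Z-\nabla^N_{[X,Y]}Z$. A submanifold is called biharmonic if its inclusion map, taken with the induced metric, is a biharmonic isometric immersion. It is proper biharmonic if it is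 biharmonic and not minimal.
   Formalization: The "only if" direction is stated only for non-minimal φ: for p=z, q=-z every plane z=c is minimal, hence biharmonic, yet p''+2p'^2+q''+2q'^2=4. The "if" direction is unconditional; the equation is read at z=c. *)

theory Defs
  imports "HOL-Analysis.Analysis"
begin

section \<open>Smooth maps between open subsets of Euclidean spaces\<close>

text \<open>
  Meant for open \<open>U\<close>: all iterated directional derivatives along coordinate directions are
  (Frechet) differentiable on \<open>U\<close>, that is, \<open>f\<close> is of class \<open>C\<close>-infinity.
\<close>

definition smooth_on :: "'a::euclidean_space set \<Rightarrow> ('a \<Rightarrow> 'b::real_normed_vector) \<Rightarrow> bool" where
  "smooth_on U f \<longleftrightarrow>
     (\<forall>vs \<in> lists Basis. (foldr (\<lambda>v F x. frechet_derivative F (at x) v) vs f) differentiable_on U)"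

abbreviation differential ::
  "('a::real_normed_vector \<Rightarrow> 'b::real_normed_vector) \<Rightarrow> 'a \<Rightarrow> 'a \<Rightarrow> 'b" where
  "differential f x \<equiv> frechet_derivative f (at x)"


section \<open>Riemannian geometry in a global chart\<close>

text \<open>
  All manifolds here are open subsets of some \<open>real ^ 'n\<close>.  Tangent vectors, vector fields and
  vector fields along maps are given by their components in the coordinate frame
  \<open>axis i 1\<close>, so the derivative of such a field is the derivative of its components.
\<close>

type_synonym 'n metric = "real ^ 'n \<Rightarrow> real ^ 'n \<Rightarrow> real ^ 'n \<Rightarrow> real"
type_synonym 'n vector_field = "real ^ 'n \<Rightarrow> real ^ 'n"

definition riemannian_metric :: "(real ^ 'n) set \<Rightarrow> 'n::finite metric \<Rightarrow> bool" where
  "riemannian_metric U g \<longleftrightarrow>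
     open U \<and> (\<forall>u v. smooth_on U (\<lambda>x. g x u v)) \<and>
     (\<forall>x\<in>U. bilinear (g x) \<and> (\<forall>u v. g x u v = g x v u) \<and> (\<forall>v. v \<noteq> 0 \<longrightarrow> g x v v > 0))"

definition gram_matrix :: "'n::finite metric \<Rightarrow> real ^ 'n \<Rightarrow> real ^ 'n ^ 'n" where
  "gram_matrix g x = (\<chi> i j. g x (axis i 1) (axis j 1))"

definition metric_trace ::
  "'m::finite metric \<Rightarrow> real ^ 'm \<Rightarrow> (real ^ 'm \<Rightarrow> real ^ 'm \<Rightarrow> 'b::real_vector) \<Rightarrow> 'b" where
  "metric_trace g x b =
     (\<Sum>i\<in>UNIV. \<Sum>j\<in>UNIV. (matrix_inv (gram_matrix g x) $ i $ j) *\<^sub>R b (axis i 1) (axis j 1))"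

text \<open>
  The vector with components \<open>\<Gamma>\<^sup>k (u, v) = \<Sum>i j. \<Gamma>\<^sup>k\<^sub>i\<^sub>j u\<^sup>i v\<^sup>j\<close>, where
  \<open>\<Gamma>\<^sup>k\<^sub>i\<^sub>j = 1/2 g\<^sup>k\<^sup>l (\<partial>\<^sub>i g\<^sub>j\<^sub>l + \<partial>\<^sub>j g\<^sub>i\<^sub>l - \<partial>\<^sub>l g\<^sub>i\<^sub>j)\<close>.
\<close>

definition christoffel ::
  "'n::finite metric \<Rightarrow> real ^ 'n \<Rightarrow> real ^ 'n \<Rightarrow> real ^ 'n \<Rightarrow> real ^ 'n" where
  "christoffel g x u v =
     (1 / 2) *\<^sub>R (matrix_inv (gram_matrix g x) *v
       (\<chi> l. differential (\<lambda>y. g y v (axis l 1)) x u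
           + differential (\<lambda>y. g y u (axis l 1)) x v
           - differential (\<lambda>y. g y u v) x (axis l 1)))"

definition levi_civita ::
  "'n::finite metric \<Rightarrow> 'n vector_field \<Rightarrow> 'n vector_field \<Rightarrow> 'n vector_field" where
  "levi_civita g X Y = (\<lambda>x. differential Y x (X x) + christoffel g x (X x) (Y x))"

definition lie_bracket ::
  "'n::finite vector_field \<Rightarrow> 'n vector_field \<Rightarrow> 'n vector_field" where
  "lie_bracket X Y = (\<lambda>x. differential Y x (X x) - differential X x (Y x))"

definition riemann_curvature ::
  "'n::finite metric \<Rightarrow> 'n vector_field \<Rightarrow> 'n vector_field \<Rightarrow> 'n vector_field \<Rightarrow> 'n vector_field" where
  "riemann_curvature g X Y Z = (\<lambda>x.
     levi_civita g X (levi_civita g Y Z) x - levi_civita g Y (levi_civita g X Z) x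
     - levi_civita g (lie_bracket X Y) Z x)"

text \<open>
  The curvature is tensorial, so its value on tangent vectors at \<open>x\<close> may be computed from any
  extension of these to vector fields; we use the constant extensions.
\<close>

definition curvature_at ::
  "'n::finite metric \<Rightarrow> real ^ 'n \<Rightarrow> real ^ 'n \<Rightarrow> real ^ 'n \<Rightarrow> real ^ 'n \<Rightarrow> real ^ 'n" where
  "curvature_at g x u v w = riemann_curvature g (\<lambda>_. u) (\<lambda>_. v) (\<lambda>_. w) x"


section \<open>Tension and bitension fields\<close>

text \<open>
  Throughout, \<open>\<phi>\<close> maps \<open>(W, g)\<close> to \<open>(U, h)\<close>.  \<open>pullback_connection\<close> is the connection
  \<open>\<nabla>\<^sup>\<phi>\<close> on vector fields \<open>V\<close> along \<open>\<phi>\<close> induced by the Levi-Civita connection of \<open>h\<close>.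
\<close>

definition pullback_connection ::
  "'n::finite metric \<Rightarrow> (real ^ 'm \<Rightarrow> real ^ 'n) \<Rightarrow> 'm::finite vector_field
    \<Rightarrow> (real ^ 'm \<Rightarrow> real ^ 'n) \<Rightarrow> (real ^ 'm \<Rightarrow> real ^ 'n)" where
  "pullback_connection h \<phi> X V = (\<lambda>x.
     differential V x (X x) + christoffel h (\<phi> x) (differential \<phi> x (X x)) (V x))"

text \<open>\<open>(\<nabla>d\<phi>)(X, Y)\<close>; for an isometric immersion this is its second fundamental form.\<close>

definition second_fundamental_form ::
  "'m::finite metric \<Rightarrow> 'n::finite metric \<Rightarrow> (real ^ 'm \<Rightarrow> real ^ 'n)
    \<Rightarrow> 'm vector_field \<Rightarrow> 'm vector_field \<Rightarrow> (real ^ 'm \<Rightarrow> real ^ 'n)" where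
  "second_fundamental_form g h \<phi> X Y = (\<lambda>x.
     pullback_connection h \<phi> X (\<lambda>y. differential \<phi> y (Y y)) x
     - differential \<phi> x (levi_civita g X Y x))"

text \<open>
  The traces below are taken of expressions that are tensorial in the two vector field
  arguments, evaluated on constant extensions of tangent vectors.
\<close>

definition tension ::
  "'m::finite metric \<Rightarrow> 'n::finite metric \<Rightarrow> (real ^ 'm \<Rightarrow> real ^ 'n) \<Rightarrow> (real ^ 'm \<Rightarrow> real ^ 'n)" where
  "tension g h \<phi> = (\<lambda>x.
     metric_trace g x (\<lambda>u v. second_fundamental_form g h \<phi> (\<lambda>_. u) (\<lambda>_. v) x))"

definition bitension ::
  "'m::finite metric \<Rightarrow> 'n::finite metric \<Rightarrow> (real ^ 'm \<Rightarrow> real ^ 'n) \<Rightarrow> (real ^ 'm \<Rightarrow> real ^ 'n)" where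
  "bitension g h \<phi> = (\<lambda>x.
     metric_trace g x (\<lambda>u v.
       pullback_connection h \<phi> (\<lambda>_. u) (pullback_connection h \<phi> (\<lambda>_. v) (tension g h \<phi>)) x
       - pullback_connection h \<phi> (levi_civita g (\<lambda>_. u) (\<lambda>_. v)) (tension g h \<phi>) x)
     - metric_trace g x (\<lambda>u v.
       curvature_at h (\<phi> x) (differential \<phi> x u) (tension g h \<phi> x) (differential \<phi> x v)))"

definition biharmonic_map ::
  "(real ^ 'm) set \<Rightarrow> 'm::finite metric \<Rightarrow> (real ^ 'n) set \<Rightarrow> 'n::finite metric
    \<Rightarrow> (real ^ 'm \<Rightarrow> real ^ 'n) \<Rightarrow> bool" where
  "biharmonic_map W g U h \<phi> \<longleftrightarrow>
     riemannian_metric W g \<and> riemannian_metric U h \<and> smooth_on W \<phi> \<and> \<phi> ` W \<subseteq> U \<and>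
     (\<forall>x\<in>W. bitension g h \<phi> x = 0)"


section \<open>Biharmonic submanifolds\<close>

definition induced_metric ::
  "'n::finite metric \<Rightarrow> (real ^ 'm \<Rightarrow> real ^ 'n) \<Rightarrow> 'm::finite metric" where
  "induced_metric h \<phi> = (\<lambda>x u v. h (\<phi> x) (differential \<phi> x u) (differential \<phi> x v))"

definition isometric_immersion ::
  "(real ^ 'm) set \<Rightarrow> 'm::finite metric \<Rightarrow> (real ^ 'n) set \<Rightarrow> 'n::finite metric
    \<Rightarrow> (real ^ 'm \<Rightarrow> real ^ 'n) \<Rightarrow> bool" where
  "isometric_immersion W g U h \<phi> \<longleftrightarrow>
     riemannian_metric W g \<and> riemannian_metric U h \<and> smooth_on W \<phi> \<and> \<phi> ` W \<subseteq> U \<and>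
     (\<forall>x\<in>W. inj (differential \<phi> x)) \<and>
     (\<forall>x\<in>W. \<forall>u v. h (\<phi> x) (differential \<phi> x u) (differential \<phi> x v) = g x u v)"

definition mean_curvature_vector ::
  "'m::finite metric \<Rightarrow> 'n::finite metric \<Rightarrow> (real ^ 'm \<Rightarrow> real ^ 'n) \<Rightarrow> (real ^ 'm \<Rightarrow> real ^ 'n)" where
  "mean_curvature_vector g h \<phi> = (\<lambda>x. (1 / real CARD('m)) *\<^sub>R
     metric_trace g x (\<lambda>u v. second_fundamental_form g h \<phi> (\<lambda>_. u) (\<lambda>_. v) x))"

definition minimal_immersion ::
  "(real ^ 'm) set \<Rightarrow> 'm::finite metric \<Rightarrow> (real ^ 'n) set \<Rightarrow> 'n::finite metric
    \<Rightarrow> (real ^ 'm \<Rightarrow> real ^ 'n) \<Rightarrow> bool" where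
  "minimal_immersion W g U h \<phi> \<longleftrightarrow>
     isometric_immersion W g U h \<phi> \<and> (\<forall>x\<in>W. mean_curvature_vector g h \<phi> x = 0)"

definition smooth_embedding ::
  "(real ^ 'm::finite) set \<Rightarrow> (real ^ 'n::finite) set \<Rightarrow> (real ^ 'm \<Rightarrow> real ^ 'n) \<Rightarrow> bool" where
  "smooth_embedding W L \<phi> \<longleftrightarrow>
     open W \<and> smooth_on W \<phi> \<and> (\<forall>x\<in>W. inj (differential \<phi> x)) \<and> (\<exists>\<psi>. homeomorphism W L \<phi> \<psi>)"

text \<open>
  A submanifold \<open>L\<close> of \<open>U\<close> covered by one global chart is given by the parametrization
  \<open>\<phi>\<close> inverse to that chart; \<open>\<phi>\<close> is then the inclusion map of \<open>L\<close> read in the chart.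
\<close>

definition proper_biharmonic_submanifold ::
  "(real ^ 'n) set \<Rightarrow> 'n::finite metric \<Rightarrow> (real ^ 'm) set \<Rightarrow> (real ^ 'm::finite \<Rightarrow> real ^ 'n)
    \<Rightarrow> (real ^ 'n) set \<Rightarrow> bool" where
  "proper_biharmonic_submanifold U h W \<phi> L \<longleftrightarrow>
     smooth_embedding W L \<phi> \<and>
     isometric_immersion W (induced_metric h \<phi>) U h \<phi> \<and>
     biharmonic_map W (induced_metric h \<phi>) U h \<phi> \<and>
     \<not> minimal_immersion W (induced_metric h \<phi>) U h \<phi>"


section \<open>Foliations by surfaces\<close>

text \<open>
  Around each point there is a foliated chart \<open>\<psi>\<close> onto an open box such that the components of
  the trace of any leaf on the chart domain are plaques, i.e. level sets of the third coordinate.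
\<close>

definition foliated_by_surfaces :: "(real ^ 3) set \<Rightarrow> (real ^ 3) set set \<Rightarrow> bool" where
  "foliated_by_surfaces U F \<longleftrightarrow>
     open U \<and> partition_on U F \<and> (\<forall>L\<in>F. path_connected L) \<and>
     (\<forall>P\<in>U. \<exists>V (\<psi> :: real ^ 3 \<Rightarrow> real ^ 3) (\<psi>' :: real ^ 3 \<Rightarrow> real ^ 3) a b.
        open V \<and> P \<in> V \<and> V \<subseteq> U \<and>
        homeomorphism V (box a b) \<psi> \<psi>' \<and> smooth_on V \<psi> \<and> smooth_on (box a b) \<psi>' \<and>
        (\<forall>L\<in>F. \<forall>K\<in>components (L \<inter> V). \<exists>t. K = {x \<in> V. \<psi> x $ 3 = t}))"


section \<open>The metrics and planes considered\<close>

text \<open>\<open>a(z) dx\<^sup>2 + b(z) dy\<^sup>2 + dz\<^sup>2\<close>, where \<open>P = (x, y, z)\<close>.\<close>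

definition diagonal_metric :: "(real \<Rightarrow> real) \<Rightarrow> (real \<Rightarrow> real) \<Rightarrow> 3 metric" where
  "diagonal_metric a b = (\<lambda>P u v.
     a (P $ 3) * (u $ 1) * (v $ 1) + b (P $ 3) * (u $ 2) * (v $ 2) + (u $ 3) * (v $ 3))"

definition slice :: "real \<Rightarrow> real ^ 2 \<Rightarrow> real ^ 3" where
  "slice c = (\<lambda>w. vector [w $ 1, w $ 2, c])"

definition horizontal_plane :: "real \<Rightarrow> (real ^ 3) set" where
  "horizontal_plane c = {P. P $ 3 = c}"

definition upper_half_space :: "(real ^ 3) set" where
  "upper_half_space = {P. P $ 3 > 0}"

end

theory Submission
  imports Defs
begin

text \<open>
  The Christoffel symbols of \<open>a(z) dx\<^sup>2 + b(z) dy\<^sup>2 + dz\<^sup>2\<close> depend on \<open>z\<close> only and the metric induced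
  on a plane \<open>z = c\<close> is constant, so on the plane every field that occurs is constant: the tension
  field is \<open>H e\<^sub>3\<close> with \<open>H = - a'/(2a) - b'/(2b)\<close>.  In the bitension field the squares
  \<open>(a'/a)\<^sup>2\<close> and \<open>(b'/b)\<^sup>2\<close> coming from the rough Laplacian cancel those of the curvature term, which
  leaves \<open>- H/2 (a''/a + b''/b) e\<^sub>3\<close>.  For \<open>a = exp (2p)\<close> one has \<open>a''/a = 2 (p'' + 2 p'\<^sup>2)\<close>; for affine
  \<open>a\<close> and \<open>b\<close> the second derivatives vanish while \<open>H \<noteq> 0\<close>.
\<close>

section \<open>Calculus of smooth functions\<close>

lemma smooth_on_imp_differentiable_on: "smooth_on U f \<Longrightarrow> f differentiable_on U"
  unfolding smooth_on_def by (drule bspec[of _ _ "[]"]) auto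

text \<open>\<open>foldr\<close> applies the last entry of a list first, so differentiating along
  \<open>v\<close> beforehand amounts to appending \<open>v\<close> at the end.\<close>

lemma smooth_on_frechet_derivative:
  assumes "smooth_on U f" "v \<in> Basis"
  shows "smooth_on U (\<lambda>x. frechet_derivative f (at x) v)"
  unfolding smooth_on_def
proof
  fix vs :: "'a list" assume "vs \<in> lists Basis"
  then have "vs @ [v] \<in> lists Basis" using assms(2) by auto
  then show "foldr (\<lambda>v F x. frechet_derivative F (at x) v) vs (\<lambda>x. frechet_derivative f (at x) v)
      differentiable_on U"
    using assms(1) unfolding smooth_on_def by (auto dest!: bspec[of _ _ "vs @ [v]"])
qed

lemma smooth_on_imp_differentiable_at:
  "smooth_on U f \<Longrightarrow> open U \<Longrightarrow> x \<in> U \<Longrightarrow> f differentiable at x"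
  by (metis differentiable_on_eq_differentiable_at smooth_on_imp_differentiable_on)

text \<open>\<open>frechet_derivative\<close> is a choice among the maps satisfying
  \<open>has_derivative\<close>. The same maps qualify for \<open>f\<close> and for
  \<open>g\<close>, so the choices coincide, even where neither function is differentiable.\<close>

lemma frechet_derivative_cong_open:
  assumes "open U" "x \<in> U" "\<And>y. y \<in> U \<Longrightarrow> f y = g y"
  shows "frechet_derivative f (at x) = frechet_derivative g (at x)"
proof -
  have "(f has_derivative D) (at x) \<longleftrightarrow> (g has_derivative D) (at x)" for D
    using assms has_derivative_transform_within_open[of f D x UNIV U g]
      has_derivative_transform_within_open[of g D x UNIV U f] by auto
  then show ?thesis by (simp add: frechet_derivative_def)
qed

lemma differentiable_on_cong:
  assumes "f differentiable_on U" "\<And>x. x \<in> U \<Longrightarrow> f x = g x"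
  shows "g differentiable_on U"
  using assms unfolding differentiable_on_def differentiable_def
  by (metis has_derivative_transform)

text \<open>Iterated derivatives never leave the family \<open>F\<close>, so differentiability of
  its members suffices. Closure is asked only up to equality on \<open>U\<close>, since derivatives
  outside \<open>U\<close> are not controlled.\<close>

lemma smooth_on_coinduct:
  assumes U: "open U" and f: "f \<in> F"
    and diff: "\<And>f. f \<in> F \<Longrightarrow> f differentiable_on U"
    and deriv: "\<And>f v. f \<in> F \<Longrightarrow> v \<in> Basis \<Longrightarrow>
      \<exists>g\<in>F. \<forall>x\<in>U. frechet_derivative f (at x) v = g x"
  shows "smooth_on U f"
  unfolding smooth_on_def
proof
  fix vs :: "'a list" assume "vs \<in> lists Basis"
  then have "\<exists>g\<in>F. \<forall>x\<in>U. foldr (\<lambda>v F x. frechet_derivative F (at x) v) vs f x = g x"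
  proof (induction vs)
    case Nil
    then show ?case using f by auto
  next
    case (Cons v vs)
    then obtain g where g: "g \<in> F"
      "\<forall>x\<in>U. foldr (\<lambda>v F x. frechet_derivative F (at x) v) vs f x = g x" by auto
    have "frechet_derivative (foldr (\<lambda>v F x. frechet_derivative F (at x) v) vs f) (at x)
        = frechet_derivative g (at x)" if "x \<in> U" for x
      using frechet_derivative_cong_open[OF U that] g(2) by blast
    then show ?case using deriv[OF g(1) Cons.hyps(1)] by auto
  qed
  then obtain g where g: "g \<in> F"
    "\<forall>x\<in>U. foldr (\<lambda>v F x. frechet_derivative F (at x) v) vs f x = g x" by auto
  then show "foldr (\<lambda>v F x. frechet_derivative F (at x) v) vs f differentiable_on U"
    using diff[OF g(1)] by (auto intro: differentiable_on_cong)
qed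

section \<open>Affine maps and the exponential function\<close>

lemma smooth_on_affine:
  fixes L :: "'a::euclidean_space \<Rightarrow> 'b::real_normed_vector"
  assumes "open U" "bounded_linear L"
  shows "smooth_on U (\<lambda>x. L x + k)"
\<comment> \<open>The derivative along \<open>v\<close> is the constant \<open>L v\<close>, and
  constants differentiate to the constant 0; so adjoining the constants closes the family.\<close>
proof (rule smooth_on_coinduct[where F = "insert (\<lambda>x. L x + k) (range (\<lambda>k x. k))"])
  have D: "((\<lambda>x. L x + k) has_derivative L) (at x)" for x
    using bounded_linear_imp_has_derivative[OF assms(2)] by (rule has_derivative_add_const)
  show "f differentiable_on U" if "f \<in> insert (\<lambda>x. L x + k) (range (\<lambda>k x. k))" for f
    using that differentiable_at_withinI[OF differentiableI[OF D]] by (auto simp: differentiable_on_def)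
  show "\<exists>g\<in>insert (\<lambda>x. L x + k) (range (\<lambda>k x. k)). \<forall>x\<in>U. frechet_derivative f (at x) v = g x"
    if "f \<in> insert (\<lambda>x. L x + k) (range (\<lambda>k x. k))" for f v
    using that by (auto simp: frechet_derivative_at[OF D, symmetric])
qed (use assms in auto)

lemma smooth_on_const: "open U \<Longrightarrow> smooth_on U (\<lambda>x. k)"
  using smooth_on_affine[OF _ bounded_linear_zero] by auto

lemma smooth_on_bounded_linear: "open U \<Longrightarrow> bounded_linear L \<Longrightarrow> smooth_on U L"
  using smooth_on_affine[of U L 0] by simp

lemma smooth_on_exp: "smooth_on UNIV (exp :: real \<Rightarrow> real)"
proof (rule smooth_on_coinduct[where F = "{exp}"])
  show "\<exists>g\<in>{exp}. \<forall>x\<in>UNIV. frechet_derivative f (at x) v = g x"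
    if "f \<in> {exp}" "v \<in> Basis" for f :: "real \<Rightarrow> real" and v
  proof -
    have "frechet_derivative exp (at x) v = exp x" for x :: real
      using frechet_derivative_at[OF DERIV_exp[of x, unfolded has_field_derivative_def]] that(2)
      by (metis Basis_real_def mult.right_neutral singletonD)
    then show ?thesis using that(1) by auto
  qed
  show "f differentiable_on UNIV" if "f \<in> {exp}" for f :: "real \<Rightarrow> real"
    using that DERIV_exp unfolding differentiable_on_eq_differentiable_at[OF open_UNIV] real_differentiable_def
    by blast
qed auto

section \<open>Sums, products and compositions\<close>

text \<open>
  Smoothness of sums, products and compositions comes from one coinduction: the functions
  generated from smooth ones by these operations are closed under differentiation.
\<close>

inductive smooth_generated :: "'a::euclidean_space set \<Rightarrow> ('a \<Rightarrow> real) \<Rightarrow> bool" for U where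
  base: "smooth_on U f \<Longrightarrow> smooth_generated U f"
| add: "smooth_generated U f \<Longrightarrow> smooth_generated U g \<Longrightarrow> smooth_generated U (\<lambda>x. f x + g x)"
| mult: "smooth_generated U f \<Longrightarrow> smooth_generated U g \<Longrightarrow> smooth_generated U (\<lambda>x. f x * g x)"
| compose: "open T \<Longrightarrow> smooth_on T r \<Longrightarrow> smooth_generated U f \<Longrightarrow> f ` U \<subseteq> T \<Longrightarrow>
    smooth_generated U (\<lambda>x. r (f x :: real))"

text \<open>The product rule brings back the undifferentiated factors, which are generated by
  hypothesis. The chain rule brings in the derivative of \<open>r\<close> at \<open>f x\<close>;
  that derivative is again smooth on \<open>T\<close>, so \<open>compose\<close> applies to
  it.\<close>

lemma smooth_generated_frechet_derivative:
  assumes "smooth_generated U f" "open U"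
  shows "f differentiable_on U \<and>
    (\<forall>v\<in>Basis. \<exists>g. smooth_generated U g \<and> (\<forall>x\<in>U. frechet_derivative f (at x) v = g x))"
  using assms(1)
proof induction
  case (base f)
  then show ?case
    using smooth_on_imp_differentiable_on smooth_on_frechet_derivative smooth_generated.base by blast
next
  case (add f g)
  have "frechet_derivative (\<lambda>x. f x + g x) (at x) v =
      frechet_derivative f (at x) v + frechet_derivative g (at x) v" if "x \<in> U" for x v
  proof -
    have "f differentiable at x" "g differentiable at x"
      using add.IH that assms(2) by (auto simp: differentiable_on_eq_differentiable_at)
    then have D: "((\<lambda>x. f x + g x) has_derivative
        (\<lambda>v. frechet_derivative f (at x) v + frechet_derivative g (at x) v)) (at x)"
      by (intro has_derivative_add) (auto simp flip: frechet_derivative_works)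
    show ?thesis by (simp flip: frechet_derivative_at[OF D])
  qed
  moreover have "\<exists>k. smooth_generated U k \<and>
      (\<forall>x\<in>U. frechet_derivative f (at x) v + frechet_derivative g (at x) v = k x)"
    if v: "v \<in> Basis" for v
  proof -
    obtain f' g' where "smooth_generated U f'" "\<forall>x\<in>U. frechet_derivative f (at x) v = f' x"
      "smooth_generated U g'" "\<forall>x\<in>U. frechet_derivative g (at x) v = g' x"
      using add.IH v by meson
    then show ?thesis
      by (intro exI[of _ "\<lambda>x. f' x + g' x"]) (auto intro: smooth_generated.intros)
  qed
  ultimately show ?case using add.IH by (simp add: differentiable_on_add)
next
  case (mult f g)
  have "frechet_derivative (\<lambda>x. f x * g x) (at x) v =
      f x * frechet_derivative g (at x) v + frechet_derivative f (at x) v * g x" if "x \<in> U" for x v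
  proof -
    have "f differentiable at x" "g differentiable at x"
      using mult.IH that assms(2) by (auto simp: differentiable_on_eq_differentiable_at)
    then have D: "((\<lambda>x. f x * g x) has_derivative
        (\<lambda>v. f x * frechet_derivative g (at x) v + frechet_derivative f (at x) v * g x)) (at x)"
      by (intro has_derivative_mult) (auto simp flip: frechet_derivative_works)
    show ?thesis by (simp flip: frechet_derivative_at[OF D])
  qed
  moreover have "\<exists>k. smooth_generated U k \<and>
      (\<forall>x\<in>U. f x * frechet_derivative g (at x) v + frechet_derivative f (at x) v * g x = k x)"
    if v: "v \<in> Basis" for v
  proof -
    obtain f' g' where "smooth_generated U f'" "\<forall>x\<in>U. frechet_derivative f (at x) v = f' x"
      "smooth_generated U g'" "\<forall>x\<in>U. frechet_derivative g (at x) v = g' x"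
      using mult.IH v by meson
    then show ?thesis
      using mult.hyps
      by (intro exI[of _ "\<lambda>x. f x * g' x + f' x * g x"]) (auto intro: smooth_generated.intros)
  qed
  ultimately show ?case using mult.IH by (simp add: differentiable_on_mult)
next
  case (compose T r f)
  have r: "r differentiable at (f x)" if "x \<in> U" for x
    using compose.hyps that by (intro smooth_on_imp_differentiable_at) auto
  have f: "f differentiable at x" if "x \<in> U" for x
    using compose.IH that assms(2) by (simp add: differentiable_on_eq_differentiable_at)
  have D: "((\<lambda>x. r (f x)) has_derivative
      (\<lambda>v. frechet_derivative r (at (f x)) (frechet_derivative f (at x) v))) (at x)"
    if "x \<in> U" for x
    using has_derivative_compose[OF f[OF that, unfolded frechet_derivative_works]
        r[OF that, unfolded frechet_derivative_works]] .
  \<comment> \<open>As \<open>r\<close> has a real argument, its derivative is multiplication by its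
    value at 1. Linearity thus turns the chain rule into a product, a form that \<open>mult\<close>
    generates.\<close>
  have D': "frechet_derivative (\<lambda>x. r (f x)) (at x) v =
      frechet_derivative f (at x) v * frechet_derivative r (at (f x)) 1" if "x \<in> U" for x v
  proof -
    have "linear (frechet_derivative r (at (f x)))" using r[OF that] by (rule linear_frechet_derivative)
    from linear_cmul[OF this, of "frechet_derivative f (at x) v" 1] show ?thesis
      by (simp flip: frechet_derivative_at[OF D[OF that]])
  qed
  have r': "smooth_generated U (\<lambda>x. frechet_derivative r (at (f x)) 1)"
    by (rule smooth_generated.compose[OF compose.hyps(1) smooth_on_frechet_derivative])
      (use compose.hyps in auto)
  have diff: "(\<lambda>x. r (f x)) differentiable_on U"
    using D by (auto simp: differentiable_on_def intro!: differentiable_at_withinI[OF differentiableI])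
  have "\<exists>k. smooth_generated U k \<and> (\<forall>x\<in>U. frechet_derivative (\<lambda>x. r (f x)) (at x) v = k x)"
    if v: "v \<in> Basis" for v
  proof -
    obtain f' where "smooth_generated U f'" "\<forall>x\<in>U. frechet_derivative f (at x) v = f' x"
      using compose.IH v by meson
    then show ?thesis
      by (intro exI[of _ "\<lambda>x. f' x * frechet_derivative r (at (f x)) 1"] conjI
          smooth_generated.mult r' ballI) (simp_all only: D')
  qed
  with diff show ?case by blast
qed

lemma smooth_generated_imp_smooth_on:
  assumes "smooth_generated U f" "open U"
  shows "smooth_on U f"
proof (rule smooth_on_coinduct[where F = "Collect (smooth_generated U)"])
  fix g v assume g: "g \<in> Collect (smooth_generated U)"
  show "g differentiable_on U" using smooth_generated_frechet_derivative[of U g] g assms(2) by simp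
  show "\<exists>h\<in>Collect (smooth_generated U). \<forall>x\<in>U. frechet_derivative g (at x) v = h x"
    if "v \<in> Basis"
    using smooth_generated_frechet_derivative[of U g] g assms(2) that by blast
qed (use assms in auto)

lemma smooth_on_add:
  fixes f g :: "'a::euclidean_space \<Rightarrow> real"
  shows "open U \<Longrightarrow> smooth_on U f \<Longrightarrow> smooth_on U g \<Longrightarrow> smooth_on U (\<lambda>x. f x + g x)"
  by (simp add: smooth_generated_imp_smooth_on smooth_generated.add smooth_generated.base)

lemma smooth_on_mult:
  fixes f g :: "'a::euclidean_space \<Rightarrow> real"
  shows "open U \<Longrightarrow> smooth_on U f \<Longrightarrow> smooth_on U g \<Longrightarrow> smooth_on U (\<lambda>x. f x * g x)"
  by (simp add: smooth_generated_imp_smooth_on smooth_generated.mult smooth_generated.base)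

lemma smooth_on_compose:
  fixes f :: "'a::euclidean_space \<Rightarrow> real" and r :: "real \<Rightarrow> real"
  assumes "open U" "open T" "smooth_on T r" "smooth_on U f" "f ` U \<subseteq> T"
  shows "smooth_on U (\<lambda>x. r (f x))"
  by (rule smooth_generated_imp_smooth_on[OF smooth_generated.compose[OF assms(2,3) smooth_generated.base]])
    (use assms in auto)

section \<open>Derivatives of functions of one real variable\<close>

lemma deriv_eq_frechet_derivative:
  fixes f :: "real \<Rightarrow> real"
  assumes "f differentiable at x"
  shows "deriv f x = frechet_derivative f (at x) 1"
proof -
  obtain D where D: "(f has_field_derivative D) (at x)"
    using assms by (auto simp: real_differentiable_def)
  then show ?thesis
    using frechet_derivative_at[OF D[unfolded has_field_derivative_def], symmetric] DERIV_imp_deriv by simp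
qed

text \<open>The family consists of all functions that agree on \<open>U\<close> with a smooth one.
  This serves to pass from \<open>frechet_derivative\<close> to \<open>deriv\<close>, whose
  agreement is known only at points of differentiability.\<close>

lemma smooth_on_cong:
  assumes "open U" "\<And>x. x \<in> U \<Longrightarrow> f x = g x" "smooth_on U f"
  shows "smooth_on U g"
proof (rule smooth_on_coinduct[where F = "{g. \<exists>f. smooth_on U f \<and> (\<forall>x\<in>U. f x = g x)}"])
  fix g v assume "g \<in> {g. \<exists>f. smooth_on U f \<and> (\<forall>x\<in>U. f x = g x)}"
  then obtain f where f: "smooth_on U f" "\<forall>x\<in>U. f x = g x" by auto
  show "g differentiable_on U"
    using f smooth_on_imp_differentiable_on[OF f(1)] by (auto intro: differentiable_on_cong)
  show "\<exists>h\<in>{g. \<exists>f. smooth_on U f \<and> (\<forall>x\<in>U. f x = g x)}.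
      \<forall>x\<in>U. frechet_derivative g (at x) v = h x" if "v \<in> Basis"
  proof (intro bexI[of _ "\<lambda>x. frechet_derivative g (at x) v"] CollectI)
    have "frechet_derivative f (at x) = frechet_derivative g (at x)" if "x \<in> U" for x
      using frechet_derivative_cong_open[OF assms(1) that] f(2) by blast
    then show "\<exists>f. smooth_on U f \<and> (\<forall>x\<in>U. f x = frechet_derivative g (at x) v)"
      using smooth_on_frechet_derivative[OF f(1) that] by fastforce
  qed simp
qed (use assms in auto)

lemma smooth_on_deriv:
  fixes f :: "real \<Rightarrow> real"
  assumes "open U" "smooth_on U f"
  shows "smooth_on U (deriv f)"
  using smooth_on_cong[OF assms(1) _ smooth_on_frechet_derivative[OF assms(2), of 1]]
    deriv_eq_frechet_derivative smooth_on_imp_differentiable_at[OF assms(2,1)] by simp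

lemma smooth_on_has_field_derivative:
  fixes f :: "real \<Rightarrow> real"
  assumes "open U" "smooth_on U f" "x \<in> U"
  shows "(f has_field_derivative deriv f x) (at x)"
  using smooth_on_imp_differentiable_at[OF assms(2,1,3)]
  by (simp add: DERIV_deriv_iff_real_differentiable)

section \<open>Diagonal metrics\<close>

text \<open>\<open>matrix_inv\<close> is a choice among two-sided inverses, and any such X satisfies
  X = X(AB) = (XA)B = B.\<close>

lemma matrix_inv_unique:
  fixes A B :: "'a::semiring_1 ^ 'n ^ 'n"
  assumes "A ** B = mat 1" "B ** A = mat 1"
  shows "matrix_inv A = B"
  unfolding matrix_inv_def
proof (rule some_equality)
  show "X = B" if "A ** X = mat 1 \<and> X ** A = mat 1" for X
    using that assms(1) matrix_mul_assoc[of X A B] by simp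
qed (use assms in simp)

lemma matrix_inv_diagonal:
  fixes d :: "'n::finite \<Rightarrow> real"
  assumes "\<And>i. d i \<noteq> 0"
  shows "matrix_inv (\<chi> i j. if i = j then d i else 0) = (\<chi> i j. if i = j then inverse (d i) else 0)"
  by (intro matrix_inv_unique)
    (simp_all add: matrix_matrix_mult_def mat_def vec_eq_iff mult_delta_left assms)

text \<open>Allowing \<open>r\<close> to be vector-valued lets one chain rule serve both the metric
  coefficients and the Christoffel symbols.\<close>

lemma frechet_derivative_third_coordinate:
  assumes "(r has_vector_derivative r') (at (P $ 3))"
  shows "frechet_derivative (\<lambda>P :: real ^ 3. r (P $ 3)) (at P) v = v $ 3 *\<^sub>R r'"
proof -
  have "((\<lambda>P :: real ^ 3. r (P $ 3)) has_derivative (\<lambda>v. v $ 3 *\<^sub>R r')) (at P)"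
    using has_derivative_compose[OF bounded_linear_imp_has_derivative[OF bounded_linear_vec_nth]
        assms[unfolded has_vector_derivative_def]] .
  from frechet_derivative_at[OF this] show ?thesis by metis
qed

section \<open>The inclusion of a horizontal plane and its differential\<close>

definition plane_inclusion :: "real ^ 2 \<Rightarrow> real ^ 3" where
  "plane_inclusion u = u $ 1 *\<^sub>R axis 1 1 + u $ 2 *\<^sub>R axis 2 1"

lemma plane_inclusion_nth [simp]:
  "plane_inclusion u $ 1 = u $ 1" "plane_inclusion u $ 2 = u $ 2" "plane_inclusion u $ 3 = 0"
  by (simp_all add: plane_inclusion_def axis_def)

lemma slice_nth [simp]: "slice c w $ 1 = w $ 1" "slice c w $ 2 = w $ 2" "slice c w $ 3 = c"
  by (simp_all add: slice_def)

text \<open>Separating the constant vertical vector from the linear part reduces smoothness and the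
  differential of \<open>slice c\<close> to facts on affine maps.\<close>

lemma slice_eq: "slice c w = plane_inclusion w + c *\<^sub>R axis 3 1"
  by (simp add: vec_eq_iff forall_3 axis_def)

lemma bounded_linear_plane_inclusion: "bounded_linear plane_inclusion"
  unfolding plane_inclusion_def
  by (intro bounded_linear_add bounded_linear_compose[OF bounded_linear_scaleR_left]
      bounded_linear_vec_nth)

lemma smooth_on_slice: "open W \<Longrightarrow> smooth_on W (slice c)"
  using smooth_on_affine[OF _ bounded_linear_plane_inclusion, of W "c *\<^sub>R axis 3 1"]
  by (simp flip: slice_eq)

lemma differential_slice [simp]: "frechet_derivative (slice c) (at w) = plane_inclusion"
proof -
  have "(slice c has_derivative plane_inclusion) (at w)"
    unfolding slice_eq
    using has_derivative_add_const[OF bounded_linear_imp_has_derivative[OF bounded_linear_plane_inclusion]] .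
  from frechet_derivative_at[OF this] show ?thesis by simp
qed

lemma inj_plane_inclusion: "inj plane_inclusion"
proof (rule injI)
  fix u v assume "plane_inclusion u = plane_inclusion v"
  from arg_cong[OF this, of "\<lambda>w. w $ 1"] arg_cong[OF this, of "\<lambda>w. w $ 2"]
  show "u = v" by (simp add: vec_eq_iff forall_2)
qed

section \<open>Traces, Christoffel symbols and their derivatives\<close>

lemma bilinear_diagonal_metric: "bilinear (diagonal_metric a b P)"
  by (auto simp: bilinear_def diagonal_metric_def algebra_simps intro!: linearI)

lemma metric_trace_diagonal:
  assumes "gram_matrix g x = (\<chi> i j. if i = j then d i else 0)" "\<And>i. d i \<noteq> 0"
  shows "metric_trace g x B = (\<Sum>i\<in>UNIV. inverse (d i) *\<^sub>R B (axis i 1) (axis i 1))"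
proof -
  have "(\<Sum>j\<in>UNIV. (if i = j then inverse (d i) else 0) *\<^sub>R B (axis i 1) (axis j 1)) =
      inverse (d i) *\<^sub>R B (axis i 1) (axis i 1)" for i
    by (subst sum.mono_neutral_right[of UNIV "{i}"]) auto
  then show ?thesis by (simp add: metric_trace_def assms matrix_inv_diagonal)
qed

lemma gram_matrix_diagonal_metric:
  "gram_matrix (diagonal_metric a b) P =
    (\<chi> i j. if i = j then (if i = 1 then a (P $ 3) else if i = 2 then b (P $ 3) else 1) else 0)"
  by (simp add: gram_matrix_def diagonal_metric_def vec_eq_iff forall_3 axis_def)

text \<open>Common setting of both claims: \<open>S\<close> is the whole line for exponential
  coefficients and the positive half-line for affine ones.\<close>

locale smooth_diagonal_metric =
  fixes a b :: "real \<Rightarrow> real" and S :: "real set"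
  assumes open_S: "open S" and smooth_a: "smooth_on S a" and smooth_b: "smooth_on S b"
    and a_pos: "z \<in> S \<Longrightarrow> a z > 0" and b_pos: "z \<in> S \<Longrightarrow> b z > 0"
begin

abbreviation "h \<equiv> diagonal_metric a b"
abbreviation "U \<equiv> {P :: real ^ 3. P $ 3 \<in> S}"

lemma open_U: "open U"
  using open_vimage[OF open_S, of "\<lambda>P :: real ^ 3. P $ 3"] by (simp add: vimage_def continuous_intros)

lemmas deriv_a = smooth_on_has_field_derivative[OF open_S smooth_a]
lemmas deriv_b = smooth_on_has_field_derivative[OF open_S smooth_b]
lemmas deriv2_a = smooth_on_has_field_derivative[OF open_S smooth_on_deriv[OF open_S smooth_a]]
lemmas deriv2_b = smooth_on_has_field_derivative[OF open_S smooth_on_deriv[OF open_S smooth_b]]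

lemma riemannian_metric_h: "riemannian_metric U h"
  unfolding riemannian_metric_def
proof (intro conjI allI ballI impI)
  have third: "smooth_on U (\<lambda>P. P $ 3)"
    by (rule smooth_on_bounded_linear[OF open_U bounded_linear_vec_nth])
  have "smooth_on U (\<lambda>P. a (P $ 3))" "smooth_on U (\<lambda>P. b (P $ 3))"
    by (rule smooth_on_compose[OF open_U open_S _ third]; use smooth_a smooth_b in auto)+
  then show "smooth_on U (\<lambda>P. h P u v)" for u v
    unfolding diagonal_metric_def
    by (intro smooth_on_add smooth_on_mult smooth_on_const open_U)
  show "h P v v > 0" if "P \<in> U" "v \<noteq> 0" for P v
  proof -
    have "v $ 1 \<noteq> 0 \<or> v $ 2 \<noteq> 0 \<or> v $ 3 \<noteq> 0"
      using that(2) by (auto simp: vec_eq_iff forall_3)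
    moreover have "a (P $ 3) > 0" "b (P $ 3) > 0" using that a_pos b_pos by auto
    moreover have "h P v v = a (P $ 3) * (v $ 1)\<^sup>2 + b (P $ 3) * (v $ 2)\<^sup>2 + (v $ 3)\<^sup>2"
      by (simp add: diagonal_metric_def power2_eq_square)
    moreover have "a (P $ 3) * (v $ 1)\<^sup>2 \<ge> 0" "b (P $ 3) * (v $ 2)\<^sup>2 \<ge> 0"
      using calculation by auto
    moreover have "a (P $ 3) * (v $ 1)\<^sup>2 > 0 \<or> b (P $ 3) * (v $ 2)\<^sup>2 > 0 \<or> (v $ 3)\<^sup>2 > 0"
      using calculation by auto
    ultimately show ?thesis
      using zero_le_power2[of "v $ 3"] by linarith
  qed
qed (use open_U bilinear_diagonal_metric in \<open>auto simp: diagonal_metric_def\<close>)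

text \<open>The Christoffel symbols of \<open>h\<close> at height \<open>z\<close>: Gamma^1_13 =
  a'/(2a), Gamma^2_23 = b'/(2b), Gamma^3_11 = -a'/2, Gamma^3_22 = -b'/2. Scalar functions of
  \<open>z\<close> multiply fixed vectors, so the sum can be differentiated term by term.\<close>

definition connection_form :: "real \<Rightarrow> real ^ 3 \<Rightarrow> real ^ 3 \<Rightarrow> real ^ 3" where
  "connection_form z u v =
     (deriv a z / (2 * a z) * (u $ 3 * v $ 1 + u $ 1 * v $ 3)) *\<^sub>R axis 1 1
   + (deriv b z / (2 * b z) * (u $ 3 * v $ 2 + u $ 2 * v $ 3)) *\<^sub>R axis 2 1
   - ((deriv a z * (u $ 1 * v $ 1) + deriv b z * (u $ 2 * v $ 2)) / 2) *\<^sub>R axis 3 1"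

lemma connection_form_nth:
  "connection_form z u v $ 1 = deriv a z / (2 * a z) * (u $ 3 * v $ 1 + u $ 1 * v $ 3)"
  "connection_form z u v $ 2 = deriv b z / (2 * b z) * (u $ 3 * v $ 2 + u $ 2 * v $ 3)"
  "connection_form z u v $ 3 = - (deriv a z * (u $ 1 * v $ 1) + deriv b z * (u $ 2 * v $ 2)) / 2"
  by (simp_all add: connection_form_def axis_def field_simps)

lemma differential_h:
  assumes "P \<in> U"
  shows "frechet_derivative (\<lambda>y. h y u v) (at P) w =
    w $ 3 * (deriv a (P $ 3) * (u $ 1 * v $ 1) + deriv b (P $ 3) * (u $ 2 * v $ 2))"
proof -
  have "((\<lambda>z. a z * u $ 1 * v $ 1 + b z * u $ 2 * v $ 2 + u $ 3 * v $ 3) has_vector_derivative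
      deriv a (P $ 3) * (u $ 1 * v $ 1) + deriv b (P $ 3) * (u $ 2 * v $ 2)) (at (P $ 3))"
    using assms deriv_a deriv_b
    unfolding has_real_derivative_iff_has_vector_derivative[symmetric]
    by (auto intro!: derivative_eq_intros)
  from frechet_derivative_third_coordinate[OF this] show ?thesis
    by (simp add: diagonal_metric_def)
qed

lemma christoffel_h:
  assumes "P \<in> U"
  shows "christoffel h P u v = connection_form (P $ 3) u v"
proof -
  have pos: "a (P $ 3) > 0" "b (P $ 3) > 0" using assms a_pos b_pos by auto
  have inv: "matrix_inv (gram_matrix h P) = (\<chi> i j. if i = j
      then inverse (if i = 1 then a (P $ 3) else if i = 2 then b (P $ 3) else 1) else 0)"
    unfolding gram_matrix_diagonal_metric using pos by (intro matrix_inv_diagonal) auto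
  show ?thesis
    unfolding christoffel_def inv differential_h[OF assms] using pos
    by (simp add: vec_eq_iff forall_3 connection_form_nth matrix_vector_mult_def sum_3 axis_def
        field_simps)
qed

text \<open>Only the third component is computed. For horizontal \<open>u\<close> and
  \<open>v\<close> the other two vanish identically in \<open>z\<close>, so an explicit quotient
  rule can be avoided.\<close>

lemma connection_form_has_vector_derivative:
  assumes "z \<in> S"
  obtains D where "((\<lambda>z. connection_form z u v) has_vector_derivative D) (at z)"
    "D $ 3 = - (deriv (deriv a) z * (u $ 1 * v $ 1) + deriv (deriv b) z * (u $ 2 * v $ 2)) / 2"
proof -
  define A where "A = deriv (\<lambda>z. deriv a z / (2 * a z) * (u $ 3 * v $ 1 + u $ 1 * v $ 3)) z"
  define B where "B = deriv (\<lambda>z. deriv b z / (2 * b z) * (u $ 3 * v $ 2 + u $ 2 * v $ 3)) z"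
  define C where "C = (deriv (deriv a) z * (u $ 1 * v $ 1) + deriv (deriv b) z * (u $ 2 * v $ 2)) / 2"
  have nz: "a z \<noteq> 0" "b z \<noteq> 0" using a_pos[OF assms] b_pos[OF assms] by auto
  have d: "a field_differentiable at z" "deriv a field_differentiable at z"
    "b field_differentiable at z" "deriv b field_differentiable at z"
    using deriv_a deriv_b deriv2_a deriv2_b assms unfolding field_differentiable_def by blast+
  have scale: "((\<lambda>z. f z *\<^sub>R e) has_vector_derivative f' *\<^sub>R e) (at z)"
    if "(f has_field_derivative f') (at z)" for f f' and e :: "real ^ 3"
    using has_vector_derivative_scaleR[OF that has_vector_derivative_const[of e]] by simp
  have "((\<lambda>z. deriv a z / (2 * a z) * (u $ 3 * v $ 1 + u $ 1 * v $ 3)) has_field_derivative A) (at z)"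
    "((\<lambda>z. deriv b z / (2 * b z) * (u $ 3 * v $ 2 + u $ 2 * v $ 3)) has_field_derivative B) (at z)"
    unfolding A_def B_def DERIV_deriv_iff_field_differentiable using d nz
    by (auto intro!: derivative_intros)
  moreover have "((\<lambda>z. (deriv a z * (u $ 1 * v $ 1) + deriv b z * (u $ 2 * v $ 2)) / 2)
      has_field_derivative C) (at z)"
    unfolding C_def using deriv2_a[OF assms] deriv2_b[OF assms]
    by (auto intro!: derivative_eq_intros)
  ultimately have "((\<lambda>z. connection_form z u v) has_vector_derivative
      A *\<^sub>R axis 1 1 + B *\<^sub>R axis 2 1 - C *\<^sub>R axis 3 1) (at z)"
    unfolding connection_form_def by (intro has_vector_derivative_add has_vector_derivative_diff scale)
  then show thesis by (rule that) (simp add: C_def axis_def field_simps)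
qed

section \<open>Curvature in the normal direction\<close>

text \<open>
  On constant fields the connection reduces to the Christoffel symbols, which depend on the third
  coordinate only; hence only their derivative in that direction enters the curvature.
\<close>

lemma levi_civita_connection_form:
  assumes P: "P \<in> U"
    and D: "((\<lambda>z. connection_form z u v) has_vector_derivative D) (at (P $ 3))"
  shows "levi_civita h (\<lambda>_. w) (levi_civita h (\<lambda>_. u) (\<lambda>_. v)) P =
    w $ 3 *\<^sub>R D + connection_form (P $ 3) w (connection_form (P $ 3) u v)"
proof -
  have eq: "levi_civita h (\<lambda>_. u) (\<lambda>_. v) Q = connection_form (Q $ 3) u v" if "Q \<in> U" for Q
    using that by (simp add: levi_civita_def christoffel_h)
  have "frechet_derivative (levi_civita h (\<lambda>_. u) (\<lambda>_. v)) (at P) =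
      frechet_derivative (\<lambda>Q. connection_form (Q $ 3) u v) (at P)"
    by (rule frechet_derivative_cong_open[OF open_U P eq])
  then show ?thesis
    unfolding levi_civita_def[of h "\<lambda>_. w"]
    using eq[OF P] frechet_derivative_third_coordinate[OF D] P by (simp add: christoffel_h)
qed

text \<open>Write Gamma for \<open>connection_form\<close> and n for the normal vector. As Gamma(u,
  w) is vertical, Gamma(n, Gamma(u, w)) = 0, and what survives is Gamma(u, Gamma(n, w)) - t D with D
  the z-derivative of Gamma(u, w). The first term yields the squared first derivatives, the second
  one the second derivatives.\<close>

lemma curvature_at_normal:
  assumes P: "P \<in> U" and u: "u $ 3 = 0" and w: "w $ 3 = 0"
  shows "curvature_at h P u (t *\<^sub>R axis 3 1) w =
    (let z = P $ 3 in
      (t / 2 * ((deriv (deriv a) z - (deriv a z)\<^sup>2 / (2 * a z)) * (u $ 1 * w $ 1)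
              + (deriv (deriv b) z - (deriv b z)\<^sup>2 / (2 * b z)) * (u $ 2 * w $ 2))) *\<^sub>R axis 3 1)"
proof -
  let ?n = "t *\<^sub>R axis 3 1 :: real ^ 3"
  have z: "P $ 3 \<in> S" using P by simp
  obtain D where D: "((\<lambda>z. connection_form z u w) has_vector_derivative D) (at (P $ 3))"
    "D $ 3 = - (deriv (deriv a) (P $ 3) * (u $ 1 * w $ 1) + deriv (deriv b) (P $ 3) * (u $ 2 * w $ 2)) / 2"
    by (rule connection_form_has_vector_derivative[OF z])
  \<comment> \<open>\<open>E\<close> enters only with the factor \<open>u $ 3\<close>, which is 0,
    so its existence suffices.\<close>
  obtain E where E: "((\<lambda>z. connection_form z ?n w) has_vector_derivative E) (at (P $ 3))"
    by (rule connection_form_has_vector_derivative[OF z])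
  \<comment> \<open>Constant fields commute, so the derivative is taken in the direction 0.\<close>
  have bracket: "levi_civita h (lie_bracket (\<lambda>_. u) (\<lambda>_. ?n)) (\<lambda>_. w) P = 0"
    using P by (simp add: levi_civita_def lie_bracket_def christoffel_h connection_form_def)
  \<comment> \<open>These components of \<open>connection_form z u w\<close> are 0 for every
    \<open>z\<close>; uniqueness of derivatives gives the rest.\<close>
  have D12: "D $ 1 = 0" "D $ 2 = 0"
  proof -
    have "((\<lambda>z. connection_form z u w $ i) has_vector_derivative D $ i) (at (P $ 3))" for i
      using bounded_linear.has_vector_derivative[OF bounded_linear_vec_nth D(1)] .
    from this[of 1] this[of 2] show "D $ 1 = 0" "D $ 2 = 0"
      using u w vector_derivative_unique_at[OF _ has_vector_derivative_const]
      by (auto simp: connection_form_nth)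
  qed
  show ?thesis
    unfolding curvature_at_def riemann_curvature_def bracket
      levi_civita_connection_form[OF P D(1)] levi_civita_connection_form[OF P E]
    using a_pos[OF z] b_pos[OF z]
    by (simp add: vec_eq_iff forall_3 connection_form_nth axis_def Let_def u w D(2) D12
        field_simps power2_eq_square)
qed

end

section \<open>Bitension field of a horizontal plane\<close>

context smooth_diagonal_metric
begin

context
  fixes c :: real
  assumes c: "c \<in> S"
begin

abbreviation "g \<equiv> induced_metric h (slice c)"

definition tension_coefficient :: real where
  "tension_coefficient = - (deriv a c / (2 * a c) + deriv b c / (2 * b c))"

lemma slice_mem: "slice c x \<in> U"
  using c by simp

section \<open>Induced metric and second fundamental form of a plane\<close>

lemma induced_metric_slice: "g = (\<lambda>x u v. a c * (u $ 1 * v $ 1) + b c * (u $ 2 * v $ 2))"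
  by (simp add: fun_eq_iff induced_metric_def diagonal_metric_def)

lemma riemannian_metric_slice: "riemannian_metric UNIV g"
  unfolding riemannian_metric_def
proof (intro conjI allI ballI impI)
  show "g x v v > 0" if "v \<noteq> 0" for x v
  proof -
    \<comment> \<open>Positivity is inherited from \<open>h\<close> because the differential is
      injective.\<close>
    have "plane_inclusion v \<noteq> 0"
      using that injD[OF inj_plane_inclusion, of v 0] by (auto simp: plane_inclusion_def)
    then show ?thesis
      using riemannian_metric_h slice_mem unfolding riemannian_metric_def induced_metric_def by simp
  qed
qed (auto simp: induced_metric_slice smooth_on_const bilinear_def algebra_simps intro!: linearI)

lemma isometric_immersion_slice: "isometric_immersion UNIV g U h (slice c)"
  unfolding isometric_immersion_def
  using riemannian_metric_slice riemannian_metric_h smooth_on_slice[OF open_UNIV] slice_mem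
    inj_plane_inclusion
  by (auto simp: induced_metric_def)

lemma metric_trace_slice:
  "metric_trace g x B =
    inverse (a c) *\<^sub>R B (axis 1 1) (axis 1 1) + inverse (b c) *\<^sub>R B (axis 2 1) (axis 2 1)"
proof -
  have "gram_matrix g x = (\<chi> i j. if i = j then (if i = 1 then a c else b c) else 0)"
    by (simp add: gram_matrix_def induced_metric_slice vec_eq_iff forall_2 axis_def)
  then have "metric_trace g x B = (\<Sum>i\<in>UNIV. inverse (if i = 1 then a c else b c) *\<^sub>R B (axis i 1) (axis i 1))"
    using a_pos[OF c] b_pos[OF c] by (intro metric_trace_diagonal) auto
  then show ?thesis by (simp add: sum_2)
qed

text \<open>The induced metric has constant coefficients, so its Christoffel symbols vanish.\<close>

lemma levi_civita_slice: "levi_civita g (\<lambda>_. u) (\<lambda>_. v) = (\<lambda>_. 0)"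
proof -
  have "christoffel g x u v = 0" for x
    by (simp add: christoffel_def induced_metric_slice zero_vec_def[symmetric])
  then show ?thesis by (simp add: levi_civita_def fun_eq_iff)
qed

text \<open>Along the plane the third coordinate stays \<open>c\<close>. For constant
  \<open>X\<close> the result is again a constant field, so the lemma can be iterated for the rough
  Laplacian.\<close>

lemma pullback_connection_constant:
  "pullback_connection h (slice c) X (\<lambda>_. V) =
    (\<lambda>x. connection_form c (plane_inclusion (X x)) V)"
  using slice_mem by (simp add: pullback_connection_def christoffel_h fun_eq_iff)

lemma second_fundamental_form_slice:
  "second_fundamental_form g h (slice c) (\<lambda>_. u) (\<lambda>_. v) =
    (\<lambda>_. connection_form c (plane_inclusion u) (plane_inclusion v))"
  by (simp add: second_fundamental_form_def levi_civita_slice pullback_connection_constant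
      fun_eq_iff vec_eq_iff forall_3)

section \<open>Tension and bitension fields, biharmonicity and minimality\<close>

lemma tension_slice: "tension g h (slice c) = (\<lambda>_. tension_coefficient *\<^sub>R axis 3 1)"
  using a_pos[OF c] b_pos[OF c]
  by (simp add: tension_def metric_trace_slice second_fundamental_form_slice fun_eq_iff vec_eq_iff
      forall_3 connection_form_nth axis_def tension_coefficient_def field_simps)

text \<open>With H the tension coefficient, the \<open>a\<close>-part of the rough Laplacian is -H
  (a'/(2a))^2 and that of the curvature trace is H a''/(2a) - H (a'/(2a))^2; subtracting leaves -H
  a''/(2a). The \<open>b\<close>-part is analogous.\<close>

lemma bitension_slice:
  "bitension g h (slice c) x =
    (- tension_coefficient / 2 * (deriv (deriv a) c / a c + deriv (deriv b) c / b c)) *\<^sub>R axis 3 1"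
proof -
  \<comment> \<open>Disposes of the correction term of the rough Laplacian, whose direction is the
    zero field by \<open>levi_civita_slice\<close>.\<close>
  have zero: "connection_form c (plane_inclusion 0) V = 0" for V
    by (simp add: vec_eq_iff forall_3 connection_form_nth)
  note curvature = curvature_at_normal[OF slice_mem plane_inclusion_nth(3) plane_inclusion_nth(3)]
  show ?thesis
    unfolding bitension_def tension_slice pullback_connection_constant levi_civita_slice zero
      metric_trace_slice differential_slice curvature
    using a_pos[OF c] b_pos[OF c]
    by (simp add: Let_def vec_eq_iff forall_3 connection_form_nth axis_def
        field_simps power2_eq_square)
qed

text \<open>The bitension field is a product with factor H, so a minimal plane is biharmonic
  whatever the second derivatives are. Excluding minimal planes isolates the second
  alternative.\<close>

lemma biharmonic_map_slice_iff:
  "biharmonic_map UNIV g U h (slice c) \<longleftrightarrow>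
    tension_coefficient = 0 \<or> deriv (deriv a) c / a c + deriv (deriv b) c / b c = 0"
  unfolding biharmonic_map_def bitension_slice
  using riemannian_metric_slice riemannian_metric_h smooth_on_slice[OF open_UNIV] slice_mem
  by auto

lemma minimal_immersion_slice_iff:
  "minimal_immersion UNIV g U h (slice c) \<longleftrightarrow> tension_coefficient = 0"
proof -
  have "mean_curvature_vector g h (slice c) x = (1 / 2) *\<^sub>R tension g h (slice c) x" for x
    by (simp add: mean_curvature_vector_def tension_def)
  then show ?thesis
    using isometric_immersion_slice by (simp add: minimal_immersion_def tension_slice)
qed

end

end

section \<open>The foliation by horizontal planes\<close>

lemma homeomorphism_slice: "homeomorphism UNIV (horizontal_plane c) (slice c) (\<lambda>P. vector [P $ 1, P $ 2])"
proof (rule homeomorphismI)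
  show "continuous_on UNIV (slice c)"
    using smooth_on_imp_differentiable_on[OF smooth_on_slice[OF open_UNIV]]
    by (rule differentiable_imp_continuous_on)
  \<comment> \<open>The pair is rewritten as a \<open>vec_lambda\<close> so that continuity can be
    checked componentwise.\<close>
  have "continuous_on (horizontal_plane c) (\<lambda>P. (\<chi> i. if i = 1 then P $ 1 else P $ 2) :: real ^ 2)"
  proof (rule continuous_on_vec_lambda)
    show "continuous_on (horizontal_plane c) (\<lambda>P. if i = 1 then P $ 1 else P $ 2)" for i :: 2
      by (cases "i = 1") (auto intro!: continuous_intros)
  qed
  then show "continuous_on (horizontal_plane c) (\<lambda>P. vector [P $ 1, P $ 2] :: real ^ 2)"
    by (rule continuous_on_eq) (simp add: vec_eq_iff forall_2)
qed (auto simp: horizontal_plane_def vec_eq_iff forall_2 forall_3)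

lemma convex_horizontal_plane: "convex (horizontal_plane c)"
  by (auto simp: horizontal_plane_def convex_def algebra_simps simp flip: distrib_right)

text \<open>The identity on a small box around the point is a foliated chart, since the leaves are
  already level sets of the third coordinate.\<close>

lemma foliated_by_horizontal_planes:
  "foliated_by_surfaces upper_half_space (horizontal_plane ` {0<..})"
  unfolding foliated_by_surfaces_def
proof (intro conjI ballI)
  show op: "open upper_half_space"
    unfolding upper_half_space_def
    using open_halfspace_component_gt_cart .
  show "partition_on upper_half_space (horizontal_plane ` {0<..})"
  proof (rule partition_onI)
    have "slice c 0 \<in> horizontal_plane c" for c by (simp add: horizontal_plane_def)
    then show "{} \<notin> horizontal_plane ` {0<..}" by force
  qed (auto simp: upper_half_space_def horizontal_plane_def disjnt_def)
  show "path_connected L" if "L \<in> horizontal_plane ` {0<..}" for L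
    using that convex_imp_path_connected convex_horizontal_plane by auto
  show "\<exists>V (\<psi> :: real ^ 3 \<Rightarrow> real ^ 3) (\<psi>' :: real ^ 3 \<Rightarrow> real ^ 3) a b.
      open V \<and> P \<in> V \<and> V \<subseteq> upper_half_space \<and>
      homeomorphism V (box a b) \<psi> \<psi>' \<and> smooth_on V \<psi> \<and> smooth_on (box a b) \<psi>' \<and>
      (\<forall>L\<in>horizontal_plane ` {0<..}. \<forall>K\<in>components (L \<inter> V). \<exists>t. K = {x \<in> V. \<psi> x $ 3 = t})"
    if P: "P \<in> upper_half_space" for P
  proof -
    obtain a b where ab: "box a b \<subseteq> upper_half_space" "P \<in> box a b"
      using open_contains_box[OF op P] by metis
    have "\<exists>t. K = {x \<in> box a b. x $ 3 = t}"
      if L: "L \<in> horizontal_plane ` {0<..}" and K: "K \<in> components (L \<inter> box a b)" for L K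
    proof -
      obtain c where L: "L = horizontal_plane c" using L by auto
      \<comment> \<open>The trace of a plane on a box is convex, hence has no component other than
        itself.\<close>
      have "connected (L \<inter> box a b)"
        unfolding L by (intro convex_connected convex_Int convex_horizontal_plane convex_box(2))
      then have "K = L \<inter> box a b"
        using K connected_eq_components_subset_sing by blast
      then show ?thesis by (auto simp: L horizontal_plane_def)
    qed
    moreover have "smooth_on (box a b) (\<lambda>x. x)"
      by (rule smooth_on_bounded_linear[OF open_box bounded_linear_ident])
    ultimately show ?thesis
      using ab by (intro exI[of _ "box a b"] exI[of _ "\<lambda>x. x"] exI[of _ a] exI[of _ b])
        (auto simp: homeomorphism_ident)
  qed
qed

section \<open>Exponential and affine coefficients\<close>

lemma deriv_deriv_exp_double:
  fixes p :: "real \<Rightarrow> real"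
  assumes "smooth_on UNIV p"
  shows "deriv (\<lambda>z. exp (2 * p z)) c = 2 * deriv p c * exp (2 * p c)"
    and "deriv (deriv (\<lambda>z. exp (2 * p z))) c =
      (2 * deriv (deriv p) c + 4 * (deriv p c)\<^sup>2) * exp (2 * p c)"
proof -
  note p = smooth_on_has_field_derivative[OF open_UNIV assms]
    and p' = smooth_on_has_field_derivative[OF open_UNIV smooth_on_deriv[OF open_UNIV assms]]
  \<comment> \<open>An equation between functions, so that it can be rewritten under the outer
    \<open>deriv\<close>.\<close>
  have eq: "deriv (\<lambda>z. exp (2 * p z)) = (\<lambda>z. 2 * deriv p z * exp (2 * p z))"
    using p by (intro ext DERIV_imp_deriv) (auto intro!: derivative_eq_intros)
  then show "deriv (\<lambda>z. exp (2 * p z)) c = 2 * deriv p c * exp (2 * p c)" by simp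
  show "deriv (deriv (\<lambda>z. exp (2 * p z))) c =
      (2 * deriv (deriv p) c + 4 * (deriv p c)\<^sup>2) * exp (2 * p c)"
    unfolding eq using p p'
    by (intro DERIV_imp_deriv)
      (auto intro!: derivative_eq_intros simp: algebra_simps power2_eq_square)
qed

theorem theorem3p2:
  shows
    "(\<forall>(p :: real \<Rightarrow> real) (q :: real \<Rightarrow> real) (c :: real).
        smooth_on UNIV p \<and> smooth_on UNIV q \<longrightarrow>
        (let h = diagonal_metric (\<lambda>z. exp (2 * p z)) (\<lambda>z. exp (2 * q z));
             \<phi> = slice c;
             g = induced_metric h \<phi>;
             E = deriv (deriv p) c + 2 * (deriv p c)\<^sup>2 + deriv (deriv q) c + 2 * (deriv q c)\<^sup>2
         in isometric_immersion UNIV g UNIV h \<phi> \<and>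
            (E = 0 \<longrightarrow> biharmonic_map UNIV g UNIV h \<phi>) \<and>
            (\<not> minimal_immersion UNIV g UNIV h \<phi> \<longrightarrow>
               (biharmonic_map UNIV g UNIV h \<phi> \<longleftrightarrow> E = 0)))) \<and>
     (\<forall>(A :: real) (B :: real) (C :: real) (D :: real).
        A > 0 \<and> B > 0 \<and> C > 0 \<and> D > 0 \<longrightarrow>
        (let h = diagonal_metric (\<lambda>z. A * z + B) (\<lambda>z. C * z + D)
         in riemannian_metric upper_half_space h \<and>
            foliated_by_surfaces upper_half_space (horizontal_plane ` {0<..}) \<and>
            (\<forall>c>0. proper_biharmonic_submanifold upper_half_space h UNIV (slice c)
                     (horizontal_plane c))))"
proof (intro conjI allI impI)
  fix p q :: "real \<Rightarrow> real" and c :: real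
  assume "smooth_on UNIV p \<and> smooth_on UNIV q"
  then have p: "smooth_on UNIV p" and q: "smooth_on UNIV q" by auto
  have smooth: "smooth_on UNIV (\<lambda>z. exp (2 * f z))" if "smooth_on UNIV f" for f :: "real \<Rightarrow> real"
    by (rule smooth_on_compose[OF open_UNIV open_UNIV smooth_on_exp])
      (auto intro!: smooth_on_mult smooth_on_const that)
  interpret smooth_diagonal_metric "\<lambda>z. exp (2 * p z)" "\<lambda>z. exp (2 * q z)" UNIV
    by unfold_locales (auto intro: smooth p q)
  let ?E = "deriv (deriv p) c + 2 * (deriv p c)\<^sup>2 + deriv (deriv q) c + 2 * (deriv q c)\<^sup>2"
  \<comment> \<open>The second alternative of \<open>biharmonic_map_slice_iff\<close> becomes 2 E =
    0; the first is minimality of the plane.\<close>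
  have "deriv (deriv (\<lambda>z. exp (2 * p z))) c / exp (2 * p c) +
      deriv (deriv (\<lambda>z. exp (2 * q z))) c / exp (2 * q c) = 2 * ?E"
    by (simp add: deriv_deriv_exp_double p q)
  then show "let h = diagonal_metric (\<lambda>z. exp (2 * p z)) (\<lambda>z. exp (2 * q z));
             \<phi> = slice c;
             g = induced_metric h \<phi>;
             E = ?E
         in isometric_immersion UNIV g UNIV h \<phi> \<and>
            (E = 0 \<longrightarrow> biharmonic_map UNIV g UNIV h \<phi>) \<and>
            (\<not> minimal_immersion UNIV g UNIV h \<phi> \<longrightarrow>
               (biharmonic_map UNIV g UNIV h \<phi> \<longleftrightarrow> E = 0))"
    using isometric_immersion_slice[OF UNIV_I, of c] biharmonic_map_slice_iff[OF UNIV_I, of c]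
      minimal_immersion_slice_iff[OF UNIV_I, of c]
    unfolding Let_def by auto
next
  fix A B C D :: real
  assume "A > 0 \<and> B > 0 \<and> C > 0 \<and> D > 0"
  then have pos: "A > 0" "B > 0" "C > 0" "D > 0" by auto
  interpret smooth_diagonal_metric "\<lambda>z. A * z + B" "\<lambda>z. C * z + D" "{0<..}"
    using pos
    by unfold_locales (auto intro: smooth_on_affine bounded_linear_mult_right add_pos_pos)
  have U: "upper_half_space = U" by (simp add: upper_half_space_def)
  have d: "deriv (\<lambda>z. s * z + t) = (\<lambda>_. s)" for s t :: real
    by (intro ext DERIV_imp_deriv) (auto intro!: derivative_eq_intros)
  have "proper_biharmonic_submanifold upper_half_space h UNIV (slice c) (horizontal_plane c)"
    if "c > 0" for c
  proof -
    have c: "c \<in> {0<..}" using that by simp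
    have "A * c + B > 0" "C * c + D > 0" using a_pos[OF c] b_pos[OF c] .
    \<comment> \<open>Both summands of the tension coefficient have the same sign and cannot cancel,
      so the plane is not minimal.\<close>
    then have "A / (2 * (A * c + B)) > 0" "C / (2 * (C * c + D)) > 0" using pos by auto
    then have "tension_coefficient c \<noteq> 0"
      unfolding tension_coefficient_def[OF c] d by linarith
    moreover have "smooth_embedding UNIV (horizontal_plane c) (slice c)"
      unfolding smooth_embedding_def
      using smooth_on_slice[OF open_UNIV] inj_plane_inclusion homeomorphism_slice by auto
    ultimately show ?thesis
      unfolding proper_biharmonic_submanifold_def U
      using isometric_immersion_slice[OF c] biharmonic_map_slice_iff[OF c]
        minimal_immersion_slice_iff[OF c] by (simp add: d)
  qed
  then show "let h = diagonal_metric (\<lambda>z. A * z + B) (\<lambda>z. C * z + D)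
         in riemannian_metric upper_half_space h \<and>
            foliated_by_surfaces upper_half_space (horizontal_plane ` {0<..}) \<and>
            (\<forall>c>0. proper_biharmonic_submanifold upper_half_space h UNIV (slice c)
                     (horizontal_plane c))"
    using riemannian_metric_h foliated_by_horizontal_planes unfolding Let_def U by blast
qed

end
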